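(* Let $n \in \mathbb{N}$ with $n\ge 1$ and let $\mathbb{K}$ be a non-Archimedean valued field with valuation $|\cdot|$. Let $(a_j)_{j=1}^n, (b_j)_{j=1}^n \in \mathbb{K}^n$. Then $$\left|\sum_{j=1}^n a_j^2\right|\left|\sum_{k=1}^n b_k^2\right|\leq \max\left\{\left|\sum_{j=1}^n a_jb_j\right|^2,\ \max_{1\leq j<k \leq n}|a_jb_k-a_kb_j|^2\right\}.$$
   Context: A non-Archimedean valued field is a field $\mathbb{K}$ with a map $|\cdot|:\mathbb{K}\to[0,\infty)$ such that (i) $|\lambda|=0$ if and only if $\lambda=0$; (ii) $|\lambda\mu|=|\lambda||\mu|$ for all $\lambda,\mu\in\mathbb{K}$; (iii) $|\lambda+\mu|\leq\max\{|\lambda|,|\mu|\}$ for all $\lambda,\mu\in\mathbb{K}$. For $n=1$ the maximum over the empty set of pairs $j<k$ is taken to be $0$. *)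

theory Defs
  imports Complex_Main
begin

locale nonarch_valued_field =
  fixes v :: "'a::field \<Rightarrow> real"
  assumes nonneg: "0 \<le> v x"
    and eq_zero_iff: "v x = 0 \<longleftrightarrow> x = 0"
    and mult: "v (x * y) = v x * v y"
    and ultrametric: "v (x + y) \<le> max (v x) (v y)"

(* Max {} is unspecified in the library; for a family of nonnegative reals
   the maximum over the empty index set is taken to be 0. *)
definition Max0 :: "real set \<Rightarrow> real" where
  "Max0 A = (if A = {} then 0 else Max A)"

end

theory Submission
  imports Defs
begin

text \<open>
  The inequality is the Lagrange identity
  \[
    \sum_j a_j^2 \sum_k b_k^2 = \Bigl(\sum_j a_j b_j\Bigr)^2 + \sum_{j<k} (a_j b_k - a_k b_j)^2
  \]
  read through an ultrametric valuation: the value of the left-hand side factors by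
  multiplicativity, and the value of the right-hand side is at most the largest value of a summand,
  because the ultrametric inequality bounds a sum of any length by the maximum of its terms.
  The identity sums over ordered pairs \<^term>\<open>j < k\<close>, and not over all pairs followed by a
  division by two, so it is valid in every commutative ring and the argument is uniform in the
  characteristic of the field.
\<close>

text \<open>
  Raising \<^term>\<open>n\<close> by one, to \<^term>\<open>m = Suc n\<close>, adds to the last sum the terms with
  larger index \<^term>\<open>m\<close>. Expanded, these give
  \[
    b_m^2 \sum_{j \le n} a_j^2 + a_m^2 \sum_{j \le n} b_j^2 - 2 a_m b_m \sum_{j \le n} a_j b_j,
  \]
  and the last term cancels the cross term of the new square of the inner product.
\<close>
lemma Lagrange_identity:
  fixes a b :: "nat \<Rightarrow> 'a::comm_ring_1"
  shows "(\<Sum>j=1..n. (a j)\<^sup>2) * (\<Sum>k=1..n. (b k)\<^sup>2)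
    = (\<Sum>j=1..n. a j * b j)\<^sup>2 + (\<Sum>k=1..n. \<Sum>j=1..<k. (a j * b k - a k * b j)\<^sup>2)"
proof (induction n)
  case 0
  show ?case by simp
next
  case (Suc n)
  let ?m = "Suc n"
  let ?A = "\<Sum>j=1..n. (a j)\<^sup>2" and ?B = "\<Sum>j=1..n. (b j)\<^sup>2" and ?C = "\<Sum>j=1..n. a j * b j"
  have "(\<Sum>j=1..n. (a j * b ?m - a ?m * b j)\<^sup>2)
      = (\<Sum>j=1..n. (b ?m)\<^sup>2 * (a j)\<^sup>2 + (a ?m)\<^sup>2 * (b j)\<^sup>2 - 2 * a ?m * b ?m * (a j * b j))"
    by (intro sum.cong refl) (simp add: power2_eq_square algebra_simps)
  also have "\<dots> = (b ?m)\<^sup>2 * ?A + (a ?m)\<^sup>2 * ?B - 2 * a ?m * b ?m * ?C"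
    by (simp add: sum.distrib sum_subtractf sum_distrib_left)
  finally have new: "(\<Sum>j=1..<?m. (a j * b ?m - a ?m * b j)\<^sup>2)
      = (b ?m)\<^sup>2 * ?A + (a ?m)\<^sup>2 * ?B - 2 * a ?m * b ?m * ?C"
    by (simp add: atLeastLessThanSuc_atLeastAtMost)
  have "(?A + (a ?m)\<^sup>2) * (?B + (b ?m)\<^sup>2)
      = ?A * ?B + (b ?m)\<^sup>2 * ?A + (a ?m)\<^sup>2 * ?B + (a ?m)\<^sup>2 * (b ?m)\<^sup>2"
    by (simp add: algebra_simps)
  also have "\<dots> = (?C + a ?m * b ?m)\<^sup>2 + ((\<Sum>k=1..n. \<Sum>j=1..<k. (a j * b k - a k * b j)\<^sup>2)
      + ((b ?m)\<^sup>2 * ?A + (a ?m)\<^sup>2 * ?B - 2 * a ?m * b ?m * ?C))"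
    unfolding Suc.IH by (simp add: power2_eq_square algebra_simps)
  finally show ?case
    unfolding new[symmetric] by simp
qed

context nonarch_valued_field
begin

lemma power2: "v (x\<^sup>2) = (v x)\<^sup>2"
  by (simp add: power2_eq_square mult)

lemma sum_le:
  assumes "0 \<le> c" and "\<And>i. i \<in> S \<Longrightarrow> v (f i) \<le> c"
  shows "v (\<Sum>i\<in>S. f i) \<le> c"
proof -
  have zero: "v 0 = 0" by (simp add: eq_zero_iff)
  show ?thesis
    using assms(2)
  proof (induction S rule: infinite_finite_induct)
    case (insert i S)
    have "v (f i + sum f S) \<le> max (v (f i)) (v (sum f S))" by (rule ultrametric)
    also have "\<dots> \<le> c" using insert by simp
    finally show ?case using insert.hyps by simp
  qed (use zero assms(1) in simp_all)
qed

end

lemma Max0_ge: "finite A \<Longrightarrow> x \<in> A \<Longrightarrow> x \<le> Max0 A"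
  by (auto simp: Max0_def)

theorem theorem2p2:
  fixes v :: "'a::field \<Rightarrow> real" and a b :: "nat \<Rightarrow> 'a" and n :: nat
  assumes "nonarch_valued_field v"
    and "n \<ge> 1"
  shows "v (\<Sum>j=1..n. (a j)\<^sup>2) * v (\<Sum>k=1..n. (b k)\<^sup>2)
    \<le> max ((v (\<Sum>j=1..n. a j * b j))\<^sup>2)
          (Max0 {(v (a j * b k - a k * b j))\<^sup>2 | j k. 1 \<le> j \<and> j < k \<and> k \<le> n})"
    (is "_ \<le> max (?c\<^sup>2) (Max0 ?M)")
proof -
  interpret nonarch_valued_field v by fact
  have "?M \<subseteq> (\<lambda>(j, k). (v (a j * b k - a k * b j))\<^sup>2) ` ({..n} \<times> {..n})"
    by force
  then have "finite ?M"
    by (rule finite_subset) simp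
  then have term_le: "v ((a j * b k - a k * b j)\<^sup>2) \<le> max (?c\<^sup>2) (Max0 ?M)"
    if "k \<in> {1..n}" and "j \<in> {1..<k}" for j k
    unfolding power2 using that by (intro max.coboundedI2 Max0_ge) auto
  have nonneg: "0 \<le> max (?c\<^sup>2) (Max0 ?M)"
    by (simp add: le_max_iff_disj)
  have "v (\<Sum>j=1..n. (a j)\<^sup>2) * v (\<Sum>k=1..n. (b k)\<^sup>2)
      = v ((\<Sum>j=1..n. a j * b j)\<^sup>2 + (\<Sum>k=1..n. \<Sum>j=1..<k. (a j * b k - a k * b j)\<^sup>2))"
    by (simp only: mult[symmetric] Lagrange_identity)
  also have "\<dots> \<le> max (v ((\<Sum>j=1..n. a j * b j)\<^sup>2))
      (v (\<Sum>k=1..n. \<Sum>j=1..<k. (a j * b k - a k * b j)\<^sup>2))"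
    by (rule ultrametric)
  also have "\<dots> \<le> max (?c\<^sup>2) (Max0 ?M)"
  proof (rule max.boundedI)
    show "v ((\<Sum>j=1..n. a j * b j)\<^sup>2) \<le> max (?c\<^sup>2) (Max0 ?M)"
      by (simp add: power2)
    show "v (\<Sum>k=1..n. \<Sum>j=1..<k. (a j * b k - a k * b j)\<^sup>2) \<le> max (?c\<^sup>2) (Max0 ?M)"
      by (intro sum_le nonneg term_le)
  qed
  finally show ?thesis .
qed

end
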